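(* Let $E/\mathbb{Q}$ be an elliptic curve in the family $\mathcal{F}$, with conductor $N(E)$ and parameter height $H(E)$. Then $$N(E)<1.161\cdot H(E)^{10}.$$
   Context: The family is $$\mathcal{F}=\left\{E_t: y^2=x(x+1)(x+u^4)\ \middle|\ u=\frac{2t}{t^2-1},\ t\in\mathbb{Q}\setminus\{0,1,-1\}\right\},$$ which up to $\mathbb{Q}$-isomorphism consists of the elliptic curves over $\mathbb{Q}$ with rational torsion subgroup isomorphic to $\mathbb{Z}/2\mathbb{Z}\times\mathbb{Z}/8\mathbb{Z}$. Parameter height: $H(E)$ is the minimum of $\max\{|a|,|b|\}$ over all $t=a/b$ (with $a,b$ coprime integers) such that $E_t\cong E$ over $\mathbb{Q}$. Each isomorphism class has a unique representative $t=a/b$ with $0<a<b$ coprime integers of opposite parity, and this representative attains the minimum, so $H(E)=b$. *)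

theory Defs
  imports
    Complex_Main
    "HOL-Library.FuncSet"
    "HOL-Algebra.Ideal_Product"
    "HOL-Algebra.Generated_Fields"
    "HOL-Computational_Algebra.Computational_Algebra"
begin

section \<open>Weierstrass curves\<close>

text \<open>The curve \<open>y\<^sup>2 + a1 x y + a3 y = x\<^sup>3 + a2 x\<^sup>2 + a4 x + a6\<close>, with the standard
  invariants.\<close>

datatype 'a weierstrass = Weierstrass (a1: 'a) (a2: 'a) (a3: 'a) (a4: 'a) (a6: 'a)

definition b2 :: "'a::comm_ring_1 weierstrass \<Rightarrow> 'a" where
  "b2 E = a1 E ^ 2 + 4 * a2 E"

definition b4 :: "'a::comm_ring_1 weierstrass \<Rightarrow> 'a" where
  "b4 E = 2 * a4 E + a1 E * a3 E"

definition b6 :: "'a::comm_ring_1 weierstrass \<Rightarrow> 'a" where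
  "b6 E = a3 E ^ 2 + 4 * a6 E"

definition b8 :: "'a::comm_ring_1 weierstrass \<Rightarrow> 'a" where
  "b8 E = a1 E ^ 2 * a6 E + 4 * a2 E * a6 E - a1 E * a3 E * a4 E + a2 E * a3 E ^ 2 - a4 E ^ 2"

definition discriminant :: "'a::comm_ring_1 weierstrass \<Rightarrow> 'a" where
  "discriminant E = - (b2 E ^ 2) * b8 E - 8 * b4 E ^ 3 - 27 * b6 E ^ 2 + 9 * b2 E * b4 E * b6 E"

definition elliptic_curve :: "'a::field weierstrass \<Rightarrow> bool" where
  "elliptic_curve E \<longleftrightarrow> discriminant E \<noteq> 0"

text \<open>The coefficients after the substitution \<open>x = u\<^sup>2 x' + r\<close>, \<open>y = u\<^sup>3 y' + u\<^sup>2 s x' + t\<close>.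
  The isomorphisms of elliptic curves over a field are exactly these substitutions with
  \<open>u \<noteq> 0\<close> and \<open>u, r, s, t\<close> in that field.\<close>

definition change_variables ::
    "'a::field \<Rightarrow> 'a \<Rightarrow> 'a \<Rightarrow> 'a \<Rightarrow> 'a weierstrass \<Rightarrow> 'a weierstrass" where
  "change_variables u r s t E = Weierstrass
     ((a1 E + 2 * s) / u)
     ((a2 E - s * a1 E + 3 * r - s ^ 2) / u ^ 2)
     ((a3 E + r * a1 E + 2 * t) / u ^ 3)
     ((a4 E - s * a3 E + 2 * r * a2 E - (t + r * s) * a1 E + 3 * r ^ 2 - 2 * s * t) / u ^ 4)
     ((a6 E + r * a4 E + r ^ 2 * a2 E + r ^ 3 - t * a3 E - t ^ 2 - r * t * a1 E) / u ^ 6)"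

definition isomorphic :: "'a::field weierstrass \<Rightarrow> 'a weierstrass \<Rightarrow> bool" where
  "isomorphic E E' \<longleftrightarrow> (\<exists>u r s t. u \<noteq> 0 \<and> E' = change_variables u r s t E)"


section \<open>Reduction types over the rationals\<close>

definition integral_model :: "rat weierstrass \<Rightarrow> int weierstrass \<Rightarrow> bool" where
  "integral_model E W \<longleftrightarrow> isomorphic E (map_weierstrass of_int W)"

text \<open>Minimality at \<open>p\<close> is tested against models over the integers; admitting coefficients
  that are merely \<open>p\<close>-integral would give the same minimum, as an integral \<open>u\<close> prime to \<open>p\<close>
  clears the other denominators without changing the valuation of the discriminant.\<close>

definition minimal_model_at :: "nat \<Rightarrow> rat weierstrass \<Rightarrow> int weierstrass \<Rightarrow> bool" where
  "minimal_model_at p E W \<longleftrightarrow> integral_model E W \<and>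
     (\<forall>W'. integral_model E W' \<longrightarrow>
        multiplicity (int p) (discriminant W) \<le> multiplicity (int p) (discriminant W'))"

text \<open>The reduction of \<open>W\<close> mod \<open>p\<close> has a node at \<open>(x, y)\<close>: the equation and both its partial
  derivatives vanish there, and the tangent cone
  \<open>Y\<^sup>2 + a1 X Y - (3 x + a2) X\<^sup>2\<close>, a binary quadratic form, has nonzero discriminant and hence
  two distinct tangent lines over the algebraic closure (also for \<open>p = 2\<close>). A singular point
  of the reduction is unique and therefore has coordinates in the prime field.\<close>

definition has_node_mod :: "nat \<Rightarrow> int weierstrass \<Rightarrow> bool" where
  "has_node_mod p W \<longleftrightarrow> (\<exists>x y.
     int p dvd y ^ 2 + a1 W * x * y + a3 W * y - (x ^ 3 + a2 W * x ^ 2 + a4 W * x + a6 W) \<and>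
     int p dvd a1 W * y - (3 * x ^ 2 + 2 * a2 W * x + a4 W) \<and>
     int p dvd 2 * y + a1 W * x + a3 W \<and>
     \<not> int p dvd a1 W ^ 2 + 4 * (3 * x + a2 W))"

definition good_reduction :: "nat \<Rightarrow> rat weierstrass \<Rightarrow> bool" where
  "good_reduction p E \<longleftrightarrow> (\<exists>W. minimal_model_at p E W \<and> \<not> int p dvd discriminant W)"

definition multiplicative_reduction :: "nat \<Rightarrow> rat weierstrass \<Rightarrow> bool" where
  "multiplicative_reduction p E \<longleftrightarrow> (\<exists>W. minimal_model_at p E W \<and> has_node_mod p W)"


section \<open>Torsion points and their Galois action\<close>

datatype 'a point = Infinity | Affine 'a 'a

fun on_curve :: "'a::field weierstrass \<Rightarrow> 'a point \<Rightarrow> bool" where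
  "on_curve E Infinity \<longleftrightarrow> True"
| "on_curve E (Affine x y) \<longleftrightarrow>
     y ^ 2 + a1 E * x * y + a3 E * y = x ^ 3 + a2 E * x ^ 2 + a4 E * x + a6 E"

fun point_add :: "'a::field weierstrass \<Rightarrow> 'a point \<Rightarrow> 'a point \<Rightarrow> 'a point" where
  "point_add E Infinity Q = Q"
| "point_add E P Infinity = P"
| "point_add E (Affine x1 y1) (Affine x2 y2) =
     (if x1 = x2 \<and> y1 + y2 + a1 E * x2 + a3 E = 0 then Infinity
      else let l = (if x1 = x2
                    then (3 * x1 ^ 2 + 2 * a2 E * x1 + a4 E - a1 E * y1) /
                         (2 * y1 + a1 E * x1 + a3 E)
                    else (y2 - y1) / (x2 - x1));
               x3 = l ^ 2 + a1 E * l - a2 E - x1 - x2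
           in Affine x3 (- (l + a1 E) * x3 - (y1 - l * x1) - a3 E))"

definition torsion_points :: "nat \<Rightarrow> rat weierstrass \<Rightarrow> complex point set" where
  "torsion_points l E = (let E' = map_weierstrass of_rat E in
     {P. on_curve E' P \<and> (point_add E' P ^^ l) Infinity = Infinity})"

definition subring_of_complex :: "complex set \<Rightarrow> complex ring" where
  "subring_of_complex K = \<lparr>carrier = K, monoid.mult = (*), one = 1, zero = 0, add = (+)\<rparr>"

definition torsion_field :: "nat \<Rightarrow> rat weierstrass \<Rightarrow> complex set" where
  "torsion_field l E =
     generate_field (subring_of_complex UNIV) (\<Union>(set_point ` torsion_points l E))"

text \<open>Automorphisms are made \<open>extensional\<close> so that each is counted once.\<close>

definition galois_group :: "complex set \<Rightarrow> (complex \<Rightarrow> complex) set" where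
  "galois_group K = ring_iso (subring_of_complex K) (subring_of_complex K) \<inter> extensional K"

definition ring_of_integers :: "complex set \<Rightarrow> complex ring" where
  "ring_of_integers K = subring_of_complex {x \<in> K. algebraic_int x}"

definition prime_above :: "nat \<Rightarrow> complex set \<Rightarrow> complex set" where
  "prime_above p K = (SOME P. primeideal P (ring_of_integers K) \<and> of_nat p \<in> P)"

definition ideal_power :: "complex ring \<Rightarrow> complex set \<Rightarrow> nat \<Rightarrow> complex set" where
  "ideal_power R I n = (ideal_prod R I ^^ n) (carrier R)"

text \<open>The \<open>i\<close>-th ramification group, in the lower numbering, of the chosen prime above \<open>p\<close>; it
  coincides with the one of the completion. Other primes above \<open>p\<close> give conjugate groups.\<close>

definition ramification_group :: "nat \<Rightarrow> complex set \<Rightarrow> nat \<Rightarrow> (complex \<Rightarrow> complex) set" where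
  "ramification_group p K i = {\<sigma> \<in> galois_group K.
     \<forall>x \<in> carrier (ring_of_integers K).
       \<sigma> x - x \<in> ideal_power (ring_of_integers K) (prime_above p K) (i + 1)}"

definition fixed_torsion ::
    "nat \<Rightarrow> rat weierstrass \<Rightarrow> (complex \<Rightarrow> complex) set \<Rightarrow> complex point set" where
  "fixed_torsion l E G = {P \<in> torsion_points l E. \<forall>\<sigma> \<in> G. map_point \<sigma> P = P}"


section \<open>The conductor\<close>

text \<open>The wild part \<open>\<Sum>\<^bsub>i \<ge> 1\<^esub> |G\<^sub>i| / |G\<^sub>0| \<cdot> dim (E[l] / E[l]\<^bsup>G\<^sub>i\<^esup>)\<close> of the conductor
  exponent, with dimensions over the field of \<open>l\<close> elements obtained from cardinalities. It is a
  natural number independent of the prime \<open>l \<noteq> p\<close>, and is zero for \<open>p \<ge> 5\<close>. Only finitely many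
  terms are nonzero.\<close>

definition wild_exponent :: "nat \<Rightarrow> rat weierstrass \<Rightarrow> nat" where
  "wild_exponent p E = (
     let l = (if p = 2 then 3 else 2);
         G = ramification_group p (torsion_field l E)
     in THE d. real d =
          (\<Sum>i. real (card (G (Suc i))) / real (card (G 0)) *
            log (real l) (real (card (torsion_points l E)) /
                          real (card (fixed_torsion l E (G (Suc i)))))))"

definition conductor_exponent :: "nat \<Rightarrow> rat weierstrass \<Rightarrow> nat" where
  "conductor_exponent p E =
     (if good_reduction p E then 0
      else if multiplicative_reduction p E then 1
      else 2 + wild_exponent p E)"

definition conductor :: "rat weierstrass \<Rightarrow> nat" where
  "conductor E =
     (\<Prod>p \<in> {p. Factorial_Ring.prime p \<and> \<not> good_reduction p E}. p ^ conductor_exponent p E)"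


section \<open>The family and its parameter height\<close>

definition family_curve :: "rat \<Rightarrow> rat weierstrass" where
  "family_curve t = (let u = 2 * t / (t ^ 2 - 1) in Weierstrass 0 (1 + u ^ 4) 0 (u ^ 4) 0)"

definition curve_family :: "rat weierstrass set" where
  "curve_family = family_curve ` (UNIV - {0, 1, -1})"

lemma rat_square_neq_2: "x ^ 2 \<noteq> (2 :: rat)"
proof
  assume x: "x ^ 2 = 2"
  obtain a b where ab: "x = of_int a / of_int b" "b > 0" "coprime a b"
    using quotient_of_coprime quotient_of_div quotient_of_denom_pos by (metis surj_pair)
  have "(of_int (a ^ 2) :: rat) = of_int (2 * b ^ 2)"
    using x ab by (simp add: field_simps)
  then have eq: "a ^ 2 = 2 * b ^ 2" by (simp only: of_int_eq_iff)
  then have "even a" by (metis dvd_triv_left even_power zero_less_numeral)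
  then obtain c where c: "a = 2 * c" by blast
  then have "b ^ 2 = 2 * c ^ 2" using eq by (simp add: power2_eq_square)
  then have "even b" by (metis dvd_triv_left even_power zero_less_numeral)
  with \<open>even a\<close> ab(3) show False by (auto dest: coprime_common_divisor)
qed

lemma family_curve_elliptic:
  assumes "t \<notin> {0, 1, -1}"
  shows "elliptic_curve (family_curve t)"
proof -
  define u where "u = 2 * t / (t ^ 2 - 1)"
  have t: "t ^ 2 - 1 \<noteq> 0" "t \<noteq> 0" using assms by (auto simp: power2_eq_1_iff)
  have "u ^ 4 \<noteq> 1"
  proof
    assume "u ^ 4 = 1"
    then have "(u ^ 2) ^ 2 = 1" by simp
    moreover have "u ^ 2 \<ge> 0" by simp
    ultimately have "u ^ 2 = 1" by (simp only: power2_eq_1_iff) auto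
    then consider "u = 1" | "u = -1" by (auto simp: power2_eq_1_iff)
    then show False
    proof cases
      case 1
      then have "2 * t = t ^ 2 - 1" using t by (simp add: u_def)
      then have "(t - 1) ^ 2 = 2" by (simp add: power2_eq_square algebra_simps)
      then show False using rat_square_neq_2 by blast
    next
      case 2
      then have "2 * t = - (t ^ 2 - 1)" using t by (simp add: u_def divide_eq_minus_1_iff)
      then have "(t + 1) ^ 2 = 2" by (simp add: power2_eq_square algebra_simps)
      then show False using rat_square_neq_2 by blast
    qed
  qed
  moreover have "u \<noteq> 0" using t by (simp add: u_def)
  moreover have "discriminant (family_curve t) = 16 * u ^ 8 * (u ^ 4 - 1) ^ 2"
    unfolding discriminant_def b2_def b4_def b6_def b8_def family_curve_def Let_def
      u_def[symmetric] weierstrass.sel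
    by (simp add: algebra_simps power2_eq_square power3_eq_cube power4_eq_xxxx eval_nat_numeral)
  ultimately show ?thesis by (simp add: elliptic_curve_def)
qed

definition param_height :: "rat weierstrass \<Rightarrow> nat" where
  "param_height E = (LEAST n. \<exists>a b :: int.
     b \<noteq> 0 \<and> coprime a b \<and> of_int a / of_int b \<notin> {0, 1, -1 :: rat} \<and>
     isomorphic (family_curve (of_int a / of_int b)) E \<and>
     int n = max \<bar>a\<bar> \<bar>b\<bar>)"

end

theory Submission
  imports Defs
begin

text \<open>For coprime \<open>0 < a < b\<close> of opposite parity, \<open>u = 2 a b / (a\<^sup>2 - b\<^sup>2)\<close> is in lowest terms and
  \<open>E\<^sub>t\<close> is the Frey curve \<open>y\<^sup>2 = x (x + A) (x + B)\<close> with \<open>A = (b\<^sup>2 - a\<^sup>2)\<^sup>4\<close>, \<open>B = (2 a b)\<^sup>4\<close>. As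
  \<open>A \<equiv> 1\<close> mod 4, 16 divides \<open>B\<close> and \<open>A, B\<close> are coprime, it is semistable, so the wild part of the
  conductor plays no role and the conductor is the product of the primes dividing
  \<open>a b (b\<^sup>2 - a\<^sup>2) (a\<^sup>2 + b\<^sup>2) (b\<^sup>4 - 6 a\<^sup>2 b\<^sup>2 + a\<^sup>4)\<close>,
  hence at most the absolute value of this number, which is \<open>b\<^sup>1\<^sup>0\<close> times a polynomial in \<open>a / b\<close>
  whose absolute value on the unit interval stays below 1.161. When \<open>a\<close> and \<open>b\<close> are both odd,
  the involution \<open>t \<mapsto> (1 - t) / (1 + t)\<close>, which inverts \<open>u\<close>, leads to a smaller
  parameter of opposite parity.\<close>

section \<open>Isomorphisms of Weierstrass models\<close>

lemma change_variables_compose: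
  fixes E :: "'a::field weierstrass"
  assumes "u \<noteq> 0" "u' \<noteq> 0"
  shows "change_variables u' r' s' t' (change_variables u r s t E) =
    change_variables (u * u') (u ^ 2 * r' + r) (u * s' + s) (u ^ 3 * t' + u ^ 2 * s * r' + t) E"
  unfolding change_variables_def weierstrass.inject weierstrass.sel
  using assms by (intro conjI; simp add: divide_simps; Groebner_Basis.algebra)

lemma change_variables_identity: "change_variables 1 0 0 0 E = E"
  by (cases E) (simp add: change_variables_def)

lemma isomorphic_trans: "isomorphic E E' \<Longrightarrow> isomorphic E' E'' \<Longrightarrow> isomorphic E E''"
  unfolding isomorphic_def by (metis change_variables_compose mult_eq_0_iff)

lemma isomorphic_sym:
  assumes "isomorphic E E'"
  shows "isomorphic E' E"
proof -
  obtain u r s t where u: "u \<noteq> 0" and E': "E' = change_variables u r s t E"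
    using assms by (auto simp: isomorphic_def)
  \<comment> \<open>The inverse substitution, read off by solving \<open>x = u ^ 2 * x' + r\<close>,
    \<open>y = u ^ 3 * y' + u ^ 2 * s * x' + t\<close> for \<open>x'\<close> and
    \<open>y'\<close>.\<close>
  have "change_variables (1 / u) (- r / u ^ 2) (- s / u) ((r * s - t) / u ^ 3) E' =
      change_variables 1 0 0 0 E"
    unfolding E' using u by (simp add: change_variables_compose field_simps)
  then have "E = change_variables (1 / u) (- r / u ^ 2) (- s / u) ((r * s - t) / u ^ 3) E'"
    by (simp add: change_variables_identity)
  moreover have "1 / u \<noteq> 0" using u by simp
  ultimately show ?thesis unfolding isomorphic_def by blast
qed

text \<open>The classical invariant of weight 4; below it certifies minimality at
  \<open>p\<close>.\<close>

definition c4 :: "'a::comm_ring_1 weierstrass \<Rightarrow> 'a" where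
  "c4 E = b2 E ^ 2 - 24 * b4 E"

lemma
  fixes E :: "'a::field weierstrass"
  assumes "u \<noteq> 0"
  shows b2_change_variables: "u ^ 2 * b2 (change_variables u r s t E) = b2 E + 12 * r"
    and b4_change_variables: "u ^ 4 * b4 (change_variables u r s t E) = b4 E + r * b2 E + 6 * r ^ 2"
    and b6_change_variables: "u ^ 6 * b6 (change_variables u r s t E) =
      b6 E + 2 * r * b4 E + r ^ 2 * b2 E + 4 * r ^ 3"
    and b8_change_variables: "u ^ 8 * b8 (change_variables u r s t E) =
      b8 E + 3 * r * b6 E + 3 * r ^ 2 * b4 E + r ^ 3 * b2 E + 3 * r ^ 4"
  unfolding b2_def b4_def b6_def b8_def change_variables_def weierstrass.sel
  using assms by ((simp add: divide_simps; Groebner_Basis.algebra)+)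

lemma b8_relation: "4 * b8 E = b2 E * b6 E - b4 E ^ 2"
  unfolding b2_def b4_def b6_def b8_def by (simp add: algebra_simps power2_eq_square)

lemma c4_change_variables:
  assumes "u \<noteq> 0"
  shows "u ^ 4 * c4 (change_variables u r s t E) = c4 E"
proof -
  let ?E = "change_variables u r s t E"
  have "u ^ 4 * c4 ?E = (u ^ 2 * b2 ?E) ^ 2 - 24 * (u ^ 4 * b4 ?E)"
    unfolding c4_def by Groebner_Basis.algebra
  also have "\<dots> = c4 E"
    unfolding b2_change_variables[OF assms] b4_change_variables[OF assms] c4_def by Groebner_Basis.algebra
  finally show ?thesis .
qed

lemma discriminant_change_variables:
  assumes "u \<noteq> 0"
  shows "u ^ 12 * discriminant (change_variables u r s t E) = discriminant E"
proof -
  let ?E = "change_variables u r s t E"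
  have "u ^ 12 * discriminant ?E = - ((u ^ 2 * b2 ?E) ^ 2) * (u ^ 8 * b8 ?E)
      - 8 * (u ^ 4 * b4 ?E) ^ 3 - 27 * (u ^ 6 * b6 ?E) ^ 2
      + 9 * (u ^ 2 * b2 ?E) * (u ^ 4 * b4 ?E) * (u ^ 6 * b6 ?E)"
    unfolding discriminant_def by Groebner_Basis.algebra
  also have "\<dots> = discriminant E"
    unfolding b2_change_variables[OF assms] b4_change_variables[OF assms]
      b6_change_variables[OF assms] b8_change_variables[OF assms] discriminant_def
    \<comment> \<open>With the b-invariants as indeterminates the identity holds only modulo
      \<open>b8_relation\<close>.\<close>
    using b8_relation[of E] by Groebner_Basis.algebra
  finally show ?thesis .
qed

lemma c4_of_int: "c4 (map_weierstrass of_int W) = (of_int (c4 W) :: 'a::comm_ring_1)"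
  by (cases W) (simp add: c4_def b2_def b4_def)

lemma discriminant_of_int:
  "discriminant (map_weierstrass of_int W) = (of_int (discriminant W) :: 'a::comm_ring_1)"
  by (cases W) (simp add: discriminant_def b2_def b4_def b6_def b8_def)


section \<open>Semistable reduction\<close>

text \<open>Write the scaling factor as \<open>m / n\<close> in lowest terms and clear denominators
  in the transformation laws.\<close>

lemma integral_models_related:
  assumes "integral_model E W" "integral_model E W'"
  obtains m n where "coprime m n" "m \<noteq> 0" "n \<noteq> 0"
    "m ^ 4 * c4 W' = n ^ 4 * c4 W" "m ^ 12 * discriminant W' = n ^ 12 * discriminant W"
proof -
  have "isomorphic (map_weierstrass of_int W) (map_weierstrass of_int W' :: rat weierstrass)"
    using assms isomorphic_sym isomorphic_trans unfolding integral_model_def by blast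
  then obtain u r s t :: rat where u: "u \<noteq> 0"
    and W': "map_weierstrass of_int W' = change_variables u r s t (map_weierstrass of_int W)"
    by (auto simp: isomorphic_def)
  obtain m n where mn: "u = of_int m / of_int n" "n > 0" "coprime m n"
    using quotient_of_coprime quotient_of_div quotient_of_denom_pos by (metis surj_pair)
  have "u ^ 4 * of_int (c4 W') = of_int (c4 W)"
    unfolding c4_of_int[symmetric] W' by (rule c4_change_variables[OF u])
  then have "(of_int (m ^ 4 * c4 W') :: rat) = of_int (n ^ 4 * c4 W)"
    using mn by (simp add: field_simps)
  moreover have "u ^ 12 * of_int (discriminant W') = of_int (discriminant W)"
    unfolding discriminant_of_int[symmetric] W' by (rule discriminant_change_variables[OF u])
  then have "(of_int (m ^ 12 * discriminant W') :: rat) = of_int (n ^ 12 * discriminant W)"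
    using mn by (simp add: field_simps)
  ultimately show ?thesis
    using that[of m n] mn u by (simp only: of_int_eq_iff) auto
qed

text \<open>If \<open>p\<close> divides the discriminant and \<open>m / n\<close> is the scaling
  factor to another integral model, then \<open>p\<close> dividing \<open>m\<close> would force
  \<open>p\<close> to divide \<open>n\<close>, because of \<open>c4\<close>. So \<open>p\<close>
  does not divide \<open>m\<close>, and the valuation of the discriminant can only grow.\<close>

lemma minimal_model_at_if_c4:
  assumes p: "prime p" and W: "integral_model E W"
    and nz: "discriminant W \<noteq> 0"
    and c4: "int p dvd discriminant W \<Longrightarrow> \<not> int p dvd c4 W"
  shows "minimal_model_at p E W"
  unfolding minimal_model_at_def
proof (intro conjI allI impI W)
  fix W' assume W': "integral_model E W'"
  show "multiplicity (int p) (discriminant W) \<le> multiplicity (int p) (discriminant W')"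
  proof (cases "int p dvd discriminant W")
    case True
    obtain m n where mn: "coprime m n" "m \<noteq> 0" "n \<noteq> 0"
      "m ^ 4 * c4 W' = n ^ 4 * c4 W" "m ^ 12 * discriminant W' = n ^ 12 * discriminant W"
      using integral_models_related[OF W W'] .
    have pp: "prime (int p)" using p by simp
    have "\<not> int p dvd m"
    proof
      assume dvd: "int p dvd m"
      then have "int p dvd n ^ 4 * c4 W" unfolding mn(4)[symmetric]
        by (meson dvd_mult2 dvd_power_same dvd_power dvd_trans zero_less_numeral)
      then have "int p dvd n"
        using c4[OF True] pp by (meson prime_dvd_mult_iff prime_dvd_power)
      then show False
        using dvd mn(1) pp not_prime_unit coprime_common_divisor by blast
    qed
    then have "multiplicity (int p) (m ^ 12) = 0"
      using pp by (meson not_dvd_imp_multiplicity_0 prime_dvd_power)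
    moreover have nz': "discriminant W' \<noteq> 0" using mn nz by auto
    ultimately have "multiplicity (int p) (discriminant W') =
        multiplicity (int p) (m ^ 12 * discriminant W')"
      using pp mn by (subst prime_elem_multiplicity_mult_distrib) auto
    also have "\<dots> = multiplicity (int p) (n ^ 12) + multiplicity (int p) (discriminant W)"
      unfolding mn(5) using pp mn nz by (subst prime_elem_multiplicity_mult_distrib) auto
    finally show ?thesis by simp
  qed (simp add: not_dvd_imp_multiplicity_0)
qed

text \<open>The model obtained from \<open>y\<^sup>2 = x (x + A) (x + B)\<close> by \<open>x = 4 X\<close>, \<open>y = 8 Y + 4 X\<close>; it is
  integral when \<open>A \<equiv> 1\<close> mod 4 and 16 divides \<open>B\<close>.\<close>

definition frey_model :: "int \<Rightarrow> int \<Rightarrow> int weierstrass" where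
  "frey_model A B = Weierstrass 1 ((A + B - 1) div 4) 0 (A * B div 16) 0"

section \<open>Minimality and nodes of the Frey model\<close>

context
  fixes A B k l :: int
  assumes A: "A = 4 * k + 1" and B: "B = 16 * l"
begin

lemma frey_model_eq: "frey_model A B = Weierstrass 1 (k + 4 * l) 0 (A * l) 0"
proof -
  have "(A + B - 1) div 4 = k + 4 * l" using A B by simp
  moreover have "A * B div 16 = A * l" unfolding B by simp
  ultimately show ?thesis unfolding frey_model_def by simp
qed

text \<open>The curve \<open>y ^ 2 = x * (x + A) * (x + B)\<close> has discriminant
  \<open>16 * A ^ 2 * B ^ 2 * (A - B) ^ 2\<close>; scaling by \<open>u = 2\<close> divides it by
  \<open>2 ^ 12\<close>.\<close>

lemma discriminant_frey_model: "discriminant (frey_model A B) = (A * l) ^ 2 * (A - B) ^ 2"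
  unfolding frey_model_eq discriminant_def b2_def b4_def b6_def b8_def weierstrass.sel
  unfolding A B by (simp add: algebra_simps power2_eq_square power3_eq_cube)

lemma c4_frey_model: "c4 (frey_model A B) = A ^ 2 - A * B + B ^ 2"
  unfolding frey_model_eq c4_def b2_def b4_def weierstrass.sel
  unfolding A B by (simp add: algebra_simps power2_eq_square power3_eq_cube)

text \<open>A bad prime divides \<open>A\<close>, \<open>B\<close> or \<open>A - B\<close>, but not
  both \<open>A\<close> and \<open>B\<close>. Modulo these three numbers \<open>c4\<close> is
  \<open>B ^ 2\<close>, \<open>A ^ 2\<close> and \<open>A ^ 2\<close>, so it does not vanish mod
  \<open>p\<close>.\<close>

lemma frey_model_minimal:
  assumes p: "prime p" and cop: "coprime A B" and nz: "discriminant (frey_model A B) \<noteq> 0"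
    and W: "integral_model E (frey_model A B)"
  shows "minimal_model_at p E (frey_model A B)"
proof (rule minimal_model_at_if_c4[OF p W nz])
  assume "int p dvd discriminant (frey_model A B)"
  moreover have pp: "prime (int p)" using p by simp
  ultimately have "int p dvd A \<or> int p dvd B \<or> int p dvd A - B"
    unfolding discriminant_frey_model using B
    by (auto simp: prime_dvd_mult_iff prime_dvd_power_iff)
  moreover have "\<not> (int p dvd A \<and> int p dvd B)"
    using cop pp not_prime_unit coprime_common_divisor by blast
  ultimately show "\<not> int p dvd c4 (frey_model A B)"
  proof (elim disjE)
    assume *: "int p dvd A" "\<not> (int p dvd A \<and> int p dvd B)"
    have "c4 (frey_model A B) = A * (A - B) + B ^ 2" unfolding c4_frey_model by Groebner_Basis.algebra
    then show ?thesis using * pp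
      by (metis dvd_add_right_iff dvd_mult2 prime_dvd_power)
  next
    assume *: "int p dvd B" "\<not> (int p dvd A \<and> int p dvd B)"
    have "c4 (frey_model A B) = B * (B - A) + A ^ 2" unfolding c4_frey_model by Groebner_Basis.algebra
    then show ?thesis using * pp
      by (metis dvd_add_right_iff dvd_mult2 prime_dvd_power)
  next
    assume *: "int p dvd A - B" "\<not> (int p dvd A \<and> int p dvd B)"
    have "c4 (frey_model A B) = (A - B) * (- B) + A ^ 2" unfolding c4_frey_model by Groebner_Basis.algebra
    moreover have "\<not> int p dvd A" using * by (metis dvd_diff_right_iff)
    ultimately show ?thesis using * pp
      by (metis dvd_add_right_iff dvd_mult2 prime_dvd_power)
  qed
qed

lemma frey_model_node:
  assumes p: "prime p" and cop: "coprime A B"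
    and dvd: "int p dvd discriminant (frey_model A B)"
  shows "has_node_mod p (frey_model A B)"
proof -
  have pp: "prime (int p)" using p by simp
  have ndvd: "\<not> (int p dvd A \<and> int p dvd B)"
    using cop pp not_prime_unit coprime_common_divisor by blast
  have AB: "1 + 4 * (k + 4 * l) = A + B" using A B by simp
  consider "int p dvd A * l" | "int p dvd A - B"
    using dvd pp unfolding discriminant_frey_model
    by (auto simp: prime_dvd_mult_iff prime_dvd_power_iff)
  then show ?thesis
  proof cases
    case 1
    then have "int p dvd A \<or> int p dvd B"
      using B pp by (auto simp: prime_dvd_mult_iff)
    then have "\<not> int p dvd A + B"
      using ndvd by (metis dvd_add_left_iff dvd_add_right_iff)
    \<comment> \<open>The node is the origin, where the tangent cone has discriminant
      \<open>A + B\<close>.\<close>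
    then show ?thesis
      unfolding has_node_mod_def frey_model_eq weierstrass.sel using 1 AB
      by (intro exI[of _ 0]) simp
  next
    case 2
    have "\<not> int p dvd A" using 2 ndvd by (metis dvd_diff_right_iff)
    \<comment> \<open>Since \<open>p\<close> is odd, 8 has an inverse \<open>v\<close> mod
      \<open>p\<close> and a factor 16 can be cancelled.\<close>
    have "odd (A - B)" using A B by simp
    then have "odd p" using 2 by (metis dvd_trans even_of_nat)
    then have "coprime 8 (int p)"
      using coprime_power_left_iff[of "2::int" 3 "int p"] by simp
    then obtain v w where vw: "v * 8 + w * int p = 1"
      using bezout_int[of 8 "int p"] by auto
    define z where "z = v * A"
    have "8 * z - A = int p * (- (w * A))" unfolding z_def using vw by Groebner_Basis.algebra
    then have zA: "int p dvd 8 * z - A" by simp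
    have "8 * z - B = (8 * z - A) + (A - B)" by simp
    then have zB: "int p dvd 8 * z - B" using zA 2 by (metis dvd_add)
    have "coprime (int p) 16"
      using \<open>odd p\<close> coprime_power_right_iff[of "int p" "2::int" 4] by simp
    then have cancel: "int p dvd y" if "int p dvd 16 * y" for y
      using that by (simp add: coprime_dvd_mult_right_iff)
    \<comment> \<open>The node is \<open>x = - A\<close>, \<open>y = 0\<close>, that is \<open>X = - A / 4\<close>, \<open>Y = A / 8\<close>, and \<open>z \<equiv> A / 8\<close>.\<close>
    show ?thesis
      unfolding has_node_mod_def frey_model_eq weierstrass.sel
    proof (rule exI[of _ "- 2 * z"], rule exI[of _ z], intro conjI)
      \<comment> \<open>The factor 16 lets \<open>k\<close> and \<open>l\<close> be expressed by
        \<open>A\<close> and \<open>B\<close>; the result lies in the ideal of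
        \<open>8 * z - A\<close> and \<open>8 * z - B\<close>, both divisible by
        \<open>p\<close>.\<close>
      have eq1: "16 * (8 * z ^ 3 - z ^ 2 - 4 * (k + 4 * l) * z ^ 2 + 2 * A * l * z) =
          (8 * z - A) * (2 * z * (8 * z - B))"
        using A B by Groebner_Basis.algebra
      have "int p dvd 8 * z ^ 3 - z ^ 2 - 4 * (k + 4 * l) * z ^ 2 + 2 * A * l * z"
        by (rule cancel, unfold eq1) (simp add: zA)
      moreover have "z ^ 2 + 1 * (- 2 * z) * z + 0 * z -
          ((- 2 * z) ^ 3 + (k + 4 * l) * (- 2 * z) ^ 2 + A * l * (- 2 * z) + 0) =
          8 * z ^ 3 - z ^ 2 - 4 * (k + 4 * l) * z ^ 2 + 2 * A * l * z"
        by (simp add: algebra_simps power2_eq_square power3_eq_cube)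
      ultimately show "int p dvd z ^ 2 + 1 * (- 2 * z) * z + 0 * z -
          ((- 2 * z) ^ 3 + (k + 4 * l) * (- 2 * z) ^ 2 + A * l * (- 2 * z) + 0)"
        by (simp only:)
      have eq2: "16 * (z - 12 * z ^ 2 + 4 * (k + 4 * l) * z - A * l) =
          (8 * z - A) * - (8 * z - B + 8 * z) + (8 * z - B) * - (8 * z)"
        using A B by Groebner_Basis.algebra
      have "int p dvd z - 12 * z ^ 2 + 4 * (k + 4 * l) * z - A * l"
        by (rule cancel, unfold eq2) (simp only: dvd_add dvd_mult2 zA zB)
      moreover have "1 * z - (3 * (- 2 * z) ^ 2 + 2 * (k + 4 * l) * (- 2 * z) + A * l) =
          z - 12 * z ^ 2 + 4 * (k + 4 * l) * z - A * l"
        by (simp add: algebra_simps power2_eq_square)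
      ultimately show
        "int p dvd 1 * z - (3 * (- 2 * z) ^ 2 + 2 * (k + 4 * l) * (- 2 * z) + A * l)"
        by (simp only:)
      \<comment> \<open>So the discriminant of the tangent cone is congruent to \<open>- A\<close>
        mod \<open>p\<close>.\<close>
      have "A = (8 * z - A) * (- 2) - (8 * z - B) - (1 ^ 2 + 4 * (3 * (- 2 * z) + (k + 4 * l)))"
        using A B by simp
      then show "\<not> int p dvd 1 ^ 2 + 4 * (3 * (- 2 * z) + (k + 4 * l))"
        using \<open>\<not> int p dvd A\<close> zA zB by (metis dvd_diff dvd_mult2)
    qed simp
  qed
qed

end

text \<open>All exponents at bad primes are 1, so the conductor is the product of the bad primes and
  divides the radical of \<open>n\<close>.\<close>

lemma conductor_le:
  assumes n: "n > 0"
    and bad: "\<And>p. Factorial_Ring.prime p \<Longrightarrow> \<not> good_reduction p E \<Longrightarrow>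
      multiplicative_reduction p E \<and> p dvd n"
  shows "conductor E \<le> n"
proof -
  let ?S = "{p. Factorial_Ring.prime p \<and> \<not> good_reduction p E}"
  have sub: "?S \<subseteq> prime_factors n"
    using bad n by (auto simp: prime_factors_dvd)
  have "conductor E = \<Prod>?S"
    unfolding conductor_def conductor_exponent_def
    by (rule prod.cong) (use bad in auto)
  also have "\<dots> dvd \<Prod>(prime_factors n)"
    using sub by (intro prod_dvd_prod_subset) auto
  also have "\<dots> dvd (\<Prod>p\<in>prime_factors n. p ^ multiplicity p n)"
    by (intro prod_dvd_prod dvd_power) (auto simp: prime_factors_multiplicity)
  also have "\<dots> = n" using prime_factorization_nat[OF n] by simp
  finally show ?thesis using n by (rule dvd_imp_le)
qed


section \<open>The family\<close>

lemma family_curve_uminus: "family_curve (- t) = family_curve t"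
  by (simp add: family_curve_def Let_def)

text \<open>Inverting \<open>t\<close> negates \<open>u\<close>, and only \<open>u ^ 4\<close>
  enters the curve. In the degenerate cases \<open>u = 0\<close> on both sides, as division by zero
  gives 0.\<close>

lemma family_curve_inverse: "family_curve (1 / t) = family_curve t"
proof (cases "t = 0 \<or> t ^ 2 = 1")
  case False
  then have "2 * (1 / t) / ((1 / t) ^ 2 - 1) = - (2 * t / (t ^ 2 - 1))"
    by (simp add: divide_simps) (simp add: algebra_simps power2_eq_square)
  then show ?thesis unfolding family_curve_def Let_def by (simp only: power_minus_even even_numeral)
qed (auto simp: family_curve_def Let_def power_divide)

text \<open>The map inverts \<open>u\<close>, and \<open>x = u ^ 4 * x'\<close> turns the roots
  \<open>-1\<close>, \<open>- u ^ 4\<close> into \<open>- 1 / u ^ 4\<close>,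
  \<open>-1\<close>.\<close>

lemma family_curve_involution:
  assumes "t \<notin> {0, 1, -1}"
  shows "isomorphic (family_curve t) (family_curve ((1 - t) / (1 + t)))"
proof -
  define u where "u = 2 * t / (t ^ 2 - 1)"
  have t: "t ^ 2 - 1 \<noteq> 0" "t \<noteq> 0" "1 + t \<noteq> 0"
    using assms by (auto simp: power2_eq_1_iff add_eq_0_iff)
  have u: "u \<noteq> 0" using t by (simp add: u_def)
  have "((1 - t) / (1 + t)) ^ 2 - 1 = - (4 * t) / (1 + t) ^ 2"
    using t(3) by (simp add: divide_simps) Groebner_Basis.algebra
  then have eq: "2 * ((1 - t) / (1 + t)) / (((1 - t) / (1 + t)) ^ 2 - 1) = 1 / u"
    unfolding u_def using t
    by (simp add: divide_simps) (simp add: algebra_simps power2_eq_square)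
  have "family_curve ((1 - t) / (1 + t)) = change_variables (u ^ 2) 0 0 0 (family_curve t)"
    unfolding family_curve_def change_variables_def Let_def eq u_def[symmetric] using u
    by (simp add: field_simps)
  moreover have "u ^ 2 \<noteq> 0" using u by simp
  ultimately show ?thesis unfolding isomorphic_def by blast
qed

lemma odd_power4_mod4:
  fixes x :: int
  assumes "odd x"
  obtains k where "x ^ 4 = 4 * k + 1"
proof -
  obtain y where "x = 2 * y + 1" using assms by (rule oddE)
  then have "x ^ 4 = 4 * (4 * y ^ 4 + 8 * y ^ 3 + 6 * y ^ 2 + 2 * y) + 1"
    by Groebner_Basis.algebra
  then show ?thesis by (rule that)
qed

section \<open>Coprime parameters of opposite parity\<close>

context
  fixes a b :: int
  assumes ab: "0 < a" "a < b" "coprime a b" "odd (a + b)"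
begin

lemma family_curve_frey_model:
  "integral_model (family_curve (of_int a / of_int b))
     (frey_model ((b ^ 2 - a ^ 2) ^ 4) ((2 * a * b) ^ 4))"
proof -
  obtain k where k: "(b ^ 2 - a ^ 2) ^ 4 = 4 * k + 1"
    by (rule odd_power4_mod4[of "b ^ 2 - a ^ 2"]) (use ab(4) in auto)
  have l: "(2 * a * b) ^ 4 = 16 * (a * b) ^ 4" by Groebner_Basis.algebra
  define q where "q = (of_int b ^ 2 - of_int a ^ 2 :: rat)"
  define c where "c = (of_int (2 * a * b) :: rat)"
  have "a ^ 2 < b ^ 2" using ab by (intro power_strict_mono) auto
  then have "(of_int (a ^ 2) :: rat) < of_int (b ^ 2)" by (simp only: of_int_less_iff)
  then have q: "q \<noteq> 0" unfolding q_def by simp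
  define t where "t = (of_int a / of_int b :: rat)"
  have t2: "t ^ 2 - 1 = - q / of_int b ^ 2"
    using ab unfolding t_def q_def by (simp add: field_simps)
  have u: "2 * t / (t ^ 2 - 1) = - c / q"
    unfolding t2 using q ab unfolding t_def c_def by (simp add: field_simps power2_eq_square)
  have kq: "of_int k = (q ^ 4 - 1) / 4"
  proof -
    have "(of_int ((b ^ 2 - a ^ 2) ^ 4) :: rat) = of_int (4 * k + 1)" using k by simp
    then show ?thesis unfolding q_def by simp
  qed
  have lc: "of_int ((a * b) ^ 4) = c ^ 4 / 16"
    unfolding c_def by (simp add: power_mult_distrib)
  have Aq: "of_int ((b ^ 2 - a ^ 2) ^ 4) = q ^ 4" unfolding q_def by simp
  have "map_weierstrass of_int (frey_model ((b ^ 2 - a ^ 2) ^ 4) ((2 * a * b) ^ 4)) =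
      Weierstrass 1 ((q ^ 4 - 1) / 4 + 4 * (c ^ 4 / 16)) 0 (q ^ 4 * (c ^ 4 / 16)) 0"
    unfolding frey_model_eq[OF k l] weierstrass.map of_int_add of_int_mult
      Aq kq lc[unfolded of_int_mult]
    by simp
  \<comment> \<open>Scaling \<open>x\<close> by \<open>q ^ 4\<close> gives
    \<open>y ^ 2 = x * (x + A) * (x + B)\<close> with \<open>A = q ^ 4\<close>,
    \<open>B = c ^ 4\<close>; composing with \<open>x = 4 * X\<close>,
    \<open>y = 8 * Y + 4 * X\<close> yields \<open>u = 2 / q ^ 2\<close> and
    \<open>s = 1 / q ^ 2\<close>.\<close>
  also have "\<dots> = change_variables (2 / q ^ 2) 0 (1 / q ^ 2) 0 (family_curve t)"
    unfolding family_curve_def Let_def u change_variables_def weierstrass.sel weierstrass.inject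
    using q by (intro conjI; simp add: divide_simps; Groebner_Basis.algebra)
  finally show ?thesis
    unfolding integral_model_def isomorphic_def t_def[symmetric] using q
    by (metis divide_eq_0_iff power_not_zero zero_neq_numeral)
qed

lemma conductor_family_curve_le:
  assumes iso: "isomorphic (family_curve (of_int a / of_int b)) E"
  shows "int (conductor E) \<le>
    a * b * (b ^ 2 - a ^ 2) * (a ^ 2 + b ^ 2) * \<bar>b ^ 4 - 6 * a ^ 2 * b ^ 2 + a ^ 4\<bar>"
proof -
  define A B l where "A = (b ^ 2 - a ^ 2) ^ 4" and "B = (2 * a * b) ^ 4" and "l = (a * b) ^ 4"
  define M where
    "M = a * b * (b ^ 2 - a ^ 2) * (a ^ 2 + b ^ 2) * (b ^ 4 - 6 * a ^ 2 * b ^ 2 + a ^ 4)"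
  obtain k where k: "A = 4 * k + 1"
    unfolding A_def by (rule odd_power4_mod4[of "b ^ 2 - a ^ 2"]) (use ab(4) in auto)
  have l: "B = 16 * l" unfolding B_def l_def by Groebner_Basis.algebra
  have "coprime (b ^ 2 - a ^ 2) 2" using ab(4) by simp
  moreover have "coprime (b ^ 2 - a ^ 2) a"
  proof (rule coprimeI)
    fix d assume d: "d dvd b ^ 2 - a ^ 2" "d dvd a"
    then have "d dvd (b ^ 2 - a ^ 2) + a * a" by simp
    then have "d dvd b ^ 2" by (simp add: power2_eq_square)
    moreover have "coprime (b ^ 2) a" using ab(3) by (simp add: ac_simps)
    ultimately show "is_unit d" using d(2) coprime_common_divisor by blast
  qed
  moreover have "coprime (b ^ 2 - a ^ 2) b"
  proof (rule coprimeI)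
    fix d assume d: "d dvd b ^ 2 - a ^ 2" "d dvd b"
    then have "d dvd b * b - (b ^ 2 - a ^ 2)" by (metis dvd_diff dvd_mult2)
    then have "d dvd a ^ 2" by (simp add: power2_eq_square)
    moreover have "coprime (a ^ 2) b" using ab(3) by simp
    ultimately show "is_unit d" using d(2) coprime_common_divisor by blast
  qed
  ultimately have cop: "coprime A B" unfolding A_def B_def by simp
  have W: "integral_model E (frey_model A B)"
    using family_curve_frey_model isomorphic_trans[OF isomorphic_sym[OF iso]]
    unfolding integral_model_def A_def B_def by blast
  have rs: "of_int a / of_int b \<notin> {0, 1, -1 :: rat}" using ab by (auto simp: field_simps)
  \<comment> \<open>A change of variables only scales the discriminant, so nonvanishing is inherited
    from the family curve.\<close>
  have nz: "discriminant (frey_model A B) \<noteq> 0"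
  proof
    assume "discriminant (frey_model A B) = 0"
    then have 0: "discriminant (map_weierstrass of_int (frey_model A B)) = (0 :: rat)"
      by (simp add: discriminant_of_int)
    obtain u r s t where "u \<noteq> 0" "map_weierstrass of_int (frey_model A B) =
        change_variables u r s t (family_curve (of_int a / of_int b))"
      using family_curve_frey_model unfolding integral_model_def isomorphic_def A_def B_def by blast
    then have "discriminant (family_curve (of_int a / of_int b)) = 0"
      using 0 discriminant_change_variables by (metis mult_zero_right)
    then show False using family_curve_elliptic[OF rs] by (simp add: elliptic_curve_def)
  qed
  \<comment> \<open>A difference of fourth powers; the sum of squares
    \<open>(b ^ 2 - a ^ 2) ^ 2 + (2 * a * b) ^ 2\<close> is \<open>(a ^ 2 + b ^ 2) ^ 2\<close>.
    Hence the discriminant and \<open>M\<close> have the same prime divisors.\<close>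
  have "A - B = (b ^ 4 - 6 * a ^ 2 * b ^ 2 + a ^ 4) * (a ^ 2 + b ^ 2) ^ 2"
    unfolding A_def B_def by Groebner_Basis.algebra
  then have disc: "discriminant (frey_model A B) =
      (((b ^ 2 - a ^ 2) * (a * b)) ^ 4) ^ 2 *
      ((b ^ 4 - 6 * a ^ 2 * b ^ 2 + a ^ 4) * (a ^ 2 + b ^ 2) ^ 2) ^ 2"
    unfolding discriminant_frey_model[OF k l] unfolding A_def l_def
    by (simp only: power_mult_distrib)
  have M: "M \<noteq> 0" using nz unfolding disc M_def by auto
  have bad: "multiplicative_reduction p E \<and> p dvd nat \<bar>M\<bar>"
    if p: "Factorial_Ring.prime p" and ng: "\<not> good_reduction p E" for p
  proof -
    have min: "minimal_model_at p E (frey_model A B)"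
      using frey_model_minimal[OF k l p cop nz W] .
    then have dvd: "int p dvd discriminant (frey_model A B)"
      using ng unfolding good_reduction_def by blast
    have "prime (int p)" using p by simp
    then have "int p dvd M"
      using dvd unfolding disc M_def by (auto simp: prime_dvd_mult_iff prime_dvd_power_iff)
    then have "p dvd nat \<bar>M\<bar>" by simp
    moreover have "multiplicative_reduction p E"
      using min frey_model_node[OF k l p cop dvd] unfolding multiplicative_reduction_def by blast
    ultimately show ?thesis by simp
  qed
  have "conductor E \<le> nat \<bar>M\<bar>"
    by (rule conductor_le[OF _ bad]) (use M in auto)
  then have "int (conductor E) \<le> \<bar>M\<bar>" by linarith
  moreover have "a ^ 2 < b ^ 2" using ab by (intro power_strict_mono) auto
  ultimately show ?thesis using ab unfolding M_def by (simp add: abs_mult)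
qed

end

section \<open>The bound on the unit interval\<close>

lemma conductor_polynomial_less:
  fixes x :: real
  assumes "0 < x" "x < 1"
  shows "x * (1 - x ^ 4) * \<bar>1 - 6 * x ^ 2 + x ^ 4\<bar> < 1.161"
proof (cases "1 - 6 * x ^ 2 + x ^ 4 \<ge> 0")
  case True
  have "x ^ 4 \<le> x ^ 2" using assms by (intro power_decreasing) auto
  then have "1 - 6 * x ^ 2 + x ^ 4 \<le> 1" using zero_le_power2[of x] by linarith
  then have "x * (1 - x ^ 4) * (1 - 6 * x ^ 2 + x ^ 4) \<le> 1 * 1 * 1"
    using assms True by (intro mult_mono) (auto simp: power_le_one)
  then show ?thesis using True by simp
next
  case False
  \<comment> \<open>The maximum lies near \<open>14 / 17\<close>; \<open>q\<close> is the quotient on division by \<open>(x - 14 / 17)\<^sup>2\<close>, which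
    leaves a small linear remainder.\<close>
  define q where "q = 697101272 / 410338673 + 135534554 / 24137569 * x + 15805440 / 1419857 * x ^ 2
    + 827512 / 83521 * x ^ 3 + 37576 / 4913 * x ^ 4 + 1146 / 289 * x ^ 5 - 28 / 17 * x ^ 6 - x ^ 7"
  \<comment> \<open>The two negative terms of \<open>q\<close> are absorbed by its linear term, and
    its constant term exceeds 1.\<close>
  have "x ^ 6 \<le> x ^ 1" "x ^ 7 \<le> x ^ 1" using assms by (intro power_decreasing; simp)+
  moreover have "0 \<le> x ^ 2" "0 \<le> x ^ 3" "0 \<le> x ^ 4" "0 \<le> x ^ 5" using assms by simp_all
  ultimately have q: "q \<ge> 1" using assms unfolding q_def power_one_right by linarith
  have eq: "1.161 - x * (1 - x ^ 4) * (6 * x ^ 2 - 1 - x ^ 4) =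
      (x - 14 / 17) ^ 2 * q + 1048675301017 / 118587876497000 - 70179527 / 6975757441 * x"
    unfolding q_def by (simp add: field_simps power2_eq_square eval_nat_numeral)
  have "(x - 14 / 17) ^ 2 * q \<ge> (x - 14 / 17) ^ 2"
    using mult_left_mono[OF q, of "(x - 14 / 17) ^ 2"] by simp
  \<comment> \<open>Completing the square: the extra shift is half the coefficient of the linear
    remainder.\<close>
  moreover have
    "(x - 14 / 17) ^ 2 + 1048675301017 / 118587876497000 - 70179527 / 6975757441 * x > 0"
    using zero_le_power2[of "x - 14 / 17 - 70179527 / 13951514882"]
    by (simp add: power2_eq_square algebra_simps)
  ultimately have "x * (1 - x ^ 4) * (6 * x ^ 2 - 1 - x ^ 4) < 1.161"
    using eq by linarith
  moreover have "\<bar>1 - 6 * x ^ 2 + x ^ 4\<bar> = 6 * x ^ 2 - 1 - x ^ 4" using False by simp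
  ultimately show ?thesis by (simp only:)
qed

lemma conductor_family_curve_less:
  fixes a b :: int
  assumes ab: "0 < a" "a < b" "coprime a b" "odd (a + b)"
    and iso: "isomorphic (family_curve (of_int a / of_int b)) E"
  shows "real (conductor E) < 1.161 * of_int b ^ 10"
proof -
  define x where "x = real_of_int a / of_int b"
  have b: "real_of_int b > 0" and x: "0 < x" "x < 1" using ab by (simp_all add: x_def)
  have a: "real_of_int a = x * of_int b" using b by (simp add: x_def)
  let ?M = "a * b * (b ^ 2 - a ^ 2) * (a ^ 2 + b ^ 2) * \<bar>b ^ 4 - 6 * a ^ 2 * b ^ 2 + a ^ 4\<bar>"
  have "real (conductor E) \<le> of_int ?M"
    using conductor_family_curve_le[OF ab iso] by (metis of_int_le_iff of_int_of_nat_eq)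
  also have "of_int ?M = (x * of_int b) * of_int b * (of_int b ^ 2 - (x * of_int b) ^ 2) *
      ((x * of_int b) ^ 2 + of_int b ^ 2) *
      \<bar>of_int b ^ 4 - 6 * (x * of_int b) ^ 2 * of_int b ^ 2 + (x * of_int b) ^ 4\<bar>"
    by (simp add: a)
  also have "of_int b ^ 4 - 6 * (x * of_int b) ^ 2 * of_int b ^ 2 + (x * of_int b) ^ 4 =
      of_int b ^ 4 * (1 - 6 * x ^ 2 + x ^ 4)"
    by Groebner_Basis.algebra
  also have "\<bar>\<dots>\<bar> = of_int b ^ 4 * \<bar>1 - 6 * x ^ 2 + x ^ 4\<bar>"
    by (simp add: abs_mult)
  also have "(x * of_int b) * of_int b * (of_int b ^ 2 - (x * of_int b) ^ 2) *
      ((x * of_int b) ^ 2 + of_int b ^ 2) * (of_int b ^ 4 * \<bar>1 - 6 * x ^ 2 + x ^ 4\<bar>) =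
      of_int b ^ 10 * (x * (1 - x ^ 4) * \<bar>1 - 6 * x ^ 2 + x ^ 4\<bar>)"
    by Groebner_Basis.algebra
  also have "\<dots> < of_int b ^ 10 * 1.161"
    using conductor_polynomial_less[OF x] b by (intro mult_strict_left_mono) auto
  finally show ?thesis by (simp add: mult.commute)
qed

section \<open>Arbitrary parameters\<close>

lemma conductor_less_if_less:
  fixes a b :: int
  assumes ab: "0 < a" "a < b" "coprime a b"
    and iso: "isomorphic (family_curve (of_int a / of_int b)) E"
  shows "real (conductor E) < 1.161 * of_int b ^ 10"
proof (cases "odd (a + b)")
  case False
  \<comment> \<open>Here \<open>c\<close> and \<open>d\<close> are the halves of
    \<open>a + b\<close> and \<open>b - a\<close>, so \<open>d / c\<close> is the image of
    \<open>a / b\<close> under the involution. As \<open>c < b\<close>, the bound for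
    \<open>d / c\<close> suffices.\<close>
  then obtain c where c: "a + b = 2 * c" by blast
  define d where "d = b - c"
  have d: "b - a = 2 * d" using c by (simp add: d_def)
  have bc: "b = c + d" "a = c - d" using c d by simp_all
  have "coprime d c"
  proof (rule coprimeI)
    fix e assume "e dvd d" "e dvd c"
    then have "e dvd a" "e dvd b" unfolding bc by simp_all
    then show "is_unit e" using ab(3) coprime_common_divisor by blast
  qed
  moreover have "odd (d + c)"
  proof
    assume "even (d + c)"
    then have "even b" "even a" unfolding bc by simp_all
    then show False using ab(3) coprime_common_divisor[of a b 2] by simp
  qed
  moreover have "isomorphic (family_curve (of_int d / of_int c)) E"
  proof -
    have "of_int a / of_int b \<notin> {0, 1, -1 :: rat}" using ab by (auto simp: field_simps)
    note family_curve_involution[OF this]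
    moreover have "(1 - of_int a / of_int b) / (1 + of_int a / of_int b) = (of_int d / of_int c :: rat)"
    proof -
      have "1 - of_int a / of_int b = (of_int (b - a) / of_int b :: rat)"
        "1 + of_int a / of_int b = (of_int (a + b) / of_int b :: rat)"
        using ab by (simp_all add: field_simps)
      then show ?thesis using ab unfolding c d by simp
    qed
    ultimately show ?thesis using iso isomorphic_sym isomorphic_trans by metis
  qed
  moreover have "0 < d" "d < c" using ab bc by simp_all
  ultimately have "real (conductor E) < 1.161 * of_int c ^ 10"
    using conductor_family_curve_less by blast
  also have "\<dots> \<le> 1.161 * of_int b ^ 10"
    using ab bc by (intro mult_left_mono power_mono) auto
  finally show ?thesis .
qed (use conductor_family_curve_less assms in blast)

theorem mainTheorem4:
  fixes E :: "rat weierstrass"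
  assumes "E \<in> curve_family"
  shows "real (conductor E) < 1.161 * real (param_height E) ^ 10"
proof -
  let ?P = "\<lambda>n. \<exists>a b :: int.
     b \<noteq> 0 \<and> coprime a b \<and> of_int a / of_int b \<notin> {0, 1, -1 :: rat} \<and>
     isomorphic (family_curve (of_int a / of_int b)) E \<and>
     int n = max \<bar>a\<bar> \<bar>b\<bar>"
  obtain t where t: "E = family_curve t" "t \<notin> {0, 1, -1}"
    using assms by (auto simp: curve_family_def)
  obtain a b where "t = of_int a / of_int b" "b > 0" "coprime a b"
    using quotient_of_coprime quotient_of_div quotient_of_denom_pos by (metis surj_pair)
  moreover have "isomorphic E E"
    unfolding isomorphic_def using change_variables_identity by (metis one_neq_zero)
  ultimately have "?P (nat (max \<bar>a\<bar> \<bar>b\<bar>))"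
    using t by (intro exI[of _ a] exI[of _ b]) auto
  \<comment> \<open>The fraction of \<open>t\<close> itself shows that \<open>?P\<close> holds
    somewhere, so the minimum is attained.\<close>
  then have "?P (param_height E)"
    unfolding param_height_def by (rule LeastI)
  then obtain a b :: int where b: "b \<noteq> 0" and cop: "coprime a b"
    and nt: "of_int a / of_int b \<notin> {0, 1, -1 :: rat}"
    and iso: "isomorphic (family_curve (of_int a / of_int b)) E"
    and h: "int (param_height E) = max \<bar>a\<bar> \<bar>b\<bar>"
    by blast
  have a: "a \<noteq> 0" using nt by auto
  have ne: "\<bar>a\<bar> \<noteq> \<bar>b\<bar>" using nt b by (auto simp: abs_eq_iff)
  \<comment> \<open>Sign changes and inversion keep the curve, so the minimizing parameter may be
    taken in the unit interval, with the height as its denominator.\<close>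
  have "family_curve (of_int \<bar>a\<bar> / of_int \<bar>b\<bar>) = family_curve (of_int a / of_int b)"
    using family_curve_uminus by (cases "a < 0"; cases "b < 0") auto
  then have iso1: "isomorphic (family_curve (of_int \<bar>a\<bar> / of_int \<bar>b\<bar>)) E" using iso by simp
  then have iso2: "isomorphic (family_curve (of_int \<bar>b\<bar> / of_int \<bar>a\<bar>)) E"
    using family_curve_inverse[of "of_int \<bar>a\<bar> / of_int \<bar>b\<bar>"] by simp
  have cop': "coprime \<bar>a\<bar> \<bar>b\<bar>" using cop by simp
  have "real (conductor E) < 1.161 * of_int (int (param_height E)) ^ 10"
  proof (cases "\<bar>a\<bar> < \<bar>b\<bar>")
    case True
    then show ?thesis unfolding h using conductor_less_if_less[OF _ True cop' iso1] a by simp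
  next
    case False
    then have less: "\<bar>b\<bar> < \<bar>a\<bar>" using ne by simp
    then show ?thesis
      unfolding h using conductor_less_if_less[OF _ less _ iso2] b cop' by (simp add: ac_simps)
  qed
  then show ?thesis by simp
qed

end
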